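(* Let $n\ge 2$. The pure twin group $PT_n$ is characteristic in $T_n$ if and only if $n=2$ or $n=3$.
   Context: For an integer $n\ge 2$, the twin group $T_n$ is the group generated by $s_1,\dots,s_{n-1}$ with defining relations $s_i^2=1$ for all $i$, and $s_is_j=s_js_i$ whenever $|i-j|\ge 2$. The pure twin group $PT_n$ is the kernel of the homomorphism $\pi:T_n\to S_n$ to the symmetric group on $n$ symbols that maps each $s_i$ to the transposition $(i,\,i+1)$. A subgroup is characteristic if it is mapped to itself by every automorphism of the group. *)

theory Defs
  imports "HOL-Algebra.Sym_Groups" "HOL-Algebra.Bij"
begin

section \<open>Group presentations\<close>

text \<open>
  A word over \<open>X\<close> is a list of signed letters: \<open>(x, True)\<close> stands for the generator \<open>x\<close> and
  \<open>(x, False)\<close> for its formal inverse. A presentation consists of a set \<open>X\<close> of generators and a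
  set \<open>R\<close> of pairs of words, where \<open>(l, r) \<in> R\<close> is the defining relation \<open>l = r\<close>. The presented
  group is the set of words modulo the least congruence (for concatenation) that contains \<open>R\<close>
  and all cancellations of adjacent mutually inverse letters.
\<close>

type_synonym 'a word = "('a \<times> bool) list"

definition words :: "'a set \<Rightarrow> 'a word set" where
  "words X = lists (X \<times> UNIV)"

inductive_set word_cong :: "'a set \<Rightarrow> ('a word \<times> 'a word) set \<Rightarrow> ('a word \<times> 'a word) set"
  for X :: "'a set" and R :: "('a word \<times> 'a word) set" where
  refl: "w \<in> words X \<Longrightarrow> (w, w) \<in> word_cong X R"
| sym: "(v, w) \<in> word_cong X R \<Longrightarrow> (w, v) \<in> word_cong X R"
| trans: "(u, v) \<in> word_cong X R \<Longrightarrow> (v, w) \<in> word_cong X R \<Longrightarrow> (u, w) \<in> word_cong X R"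
| cancel: "u \<in> words X \<Longrightarrow> v \<in> words X \<Longrightarrow> x \<in> X \<Longrightarrow>
    (u @ [(x, b), (x, \<not> b)] @ v, u @ v) \<in> word_cong X R"
| rel: "(l, r) \<in> R \<Longrightarrow> l \<in> words X \<Longrightarrow> r \<in> words X \<Longrightarrow> u \<in> words X \<Longrightarrow> v \<in> words X \<Longrightarrow>
    (u @ l @ v, u @ r @ v) \<in> word_cong X R"

definition presented_group :: "'a set \<Rightarrow> ('a word \<times> 'a word) set \<Rightarrow> 'a word set monoid" where
  "presented_group X R =
    \<lparr> carrier = words X // word_cong X R,
      mult = (\<lambda>A B. \<Union>a\<in>A. \<Union>b\<in>B. word_cong X R `` {a @ b}),
      one = word_cong X R `` {[]} \<rparr>"

definition generator :: "'a set \<Rightarrow> ('a word \<times> 'a word) set \<Rightarrow> 'a \<Rightarrow> 'a word set" where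
  "generator X R x = word_cong X R `` {[(x, True)]}"

fun eval_word :: "('g, 'm) monoid_scheme \<Rightarrow> ('a \<Rightarrow> 'g) \<Rightarrow> 'a word \<Rightarrow> 'g" where
  "eval_word G f [] = \<one>\<^bsub>G\<^esub>"
| "eval_word G f ((x, b) # w) = (if b then f x else inv\<^bsub>G\<^esub> (f x)) \<otimes>\<^bsub>G\<^esub> eval_word G f w"

text \<open>
  The homomorphism on a presented group induced by an assignment \<open>f\<close> of the generators that
  respects the relations; then \<open>eval_word\<close> is constant on each congruence class.
\<close>

definition presented_lift ::
    "('g, 'm) monoid_scheme \<Rightarrow> ('a \<Rightarrow> 'g) \<Rightarrow> 'a word set \<Rightarrow> 'g" where
  "presented_lift G f A = the_elem (eval_word G f ` A)"

lemma words_Nil [simp]: "[] \<in> words X"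
  and words_Cons [simp]: "p # w \<in> words X \<longleftrightarrow> fst p \<in> X \<and> w \<in> words X"
  and words_append [simp]: "v @ w \<in> words X \<longleftrightarrow> v \<in> words X \<and> w \<in> words X"
  by (auto simp: words_def mem_Times_iff)

lemma word_cong_words:
  "(v, w) \<in> word_cong X R \<Longrightarrow> v \<in> words X \<and> w \<in> words X"
  by (induction rule: word_cong.induct) auto

lemma equiv_word_cong: "equiv (words X) (word_cong X R)"
proof (rule equivI)
  show "word_cong X R \<subseteq> words X \<times> words X"
    using word_cong_words by fastforce
  show "refl_on (words X) (word_cong X R)"
    by (simp add: refl_on_def word_cong.refl)
  show "sym (word_cong X R)"
    by (meson symI word_cong.sym)
  show "trans (word_cong X R)"
    by (meson transI word_cong.trans)
qed

lemma word_cong_context: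
  assumes "(v, w) \<in> word_cong X R" "s \<in> words X" "t \<in> words X"
  shows "(s @ v @ t, s @ w @ t) \<in> word_cong X R"
  using assms
proof (induction rule: word_cong.induct)
  case (cancel u v x b)
  then show ?case
    using word_cong.cancel[of "s @ u" X "v @ t" x b R] by simp
next
  case (rel l r u v)
  then show ?case
    using word_cong.rel[of l r R X "s @ u" "v @ t"] by simp
qed (auto intro: word_cong.intros)

lemma word_cong_append:
  assumes "(v, v') \<in> word_cong X R" "(w, w') \<in> word_cong X R"
  shows "(v @ w, v' @ w') \<in> word_cong X R"
proof -
  have "(v @ w, v' @ w) \<in> word_cong X R"
    using word_cong_context[OF assms(1), of "[]" w] word_cong_words[OF assms(2)] by simp
  moreover have "(v' @ w, v' @ w') \<in> word_cong X R"
    using word_cong_context[OF assms(2), of v' "[]"] word_cong_words[OF assms(1)] by simp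
  ultimately show ?thesis by (rule word_cong.trans)
qed

lemma presented_group_carrierE:
  assumes "A \<in> carrier (presented_group X R)"
  obtains w where "w \<in> words X" "A = word_cong X R `` {w}"
  using assms by (auto simp: presented_group_def elim: quotientE)

lemma word_class_in_carrier:
  "w \<in> words X \<Longrightarrow> word_cong X R `` {w} \<in> carrier (presented_group X R)"
  by (simp add: presented_group_def quotientI)

lemma one_presented_group: "\<one>\<^bsub>presented_group X R\<^esub> = word_cong X R `` {[]}"
  by (simp add: presented_group_def)

lemma word_class_eqI:
  "(v, w) \<in> word_cong X R \<Longrightarrow> word_cong X R `` {v} = word_cong X R `` {w}"
  by (rule equiv_class_eq[OF equiv_word_cong])

lemma mult_presented_group:
  assumes "v \<in> words X" "w \<in> words X"
  shows "(word_cong X R `` {v}) \<otimes>\<^bsub>presented_group X R\<^esub> (word_cong X R `` {w})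
    = word_cong X R `` {v @ w}"
proof -
  have eq: "word_cong X R `` {a @ b} = word_cong X R `` {v @ w}"
    if a: "a \<in> word_cong X R `` {v}" and b: "b \<in> word_cong X R `` {w}" for a b
  proof -
    have "(v @ w, a @ b) \<in> word_cong X R"
      using a b by (intro word_cong_append) simp_all
    then show ?thesis by (rule word_class_eqI[symmetric])
  qed
  have "v \<in> word_cong X R `` {v}" "w \<in> word_cong X R `` {w}"
    using assms by (simp_all add: word_cong.refl)
  then have "(\<Union>a\<in>word_cong X R `` {v}. \<Union>b\<in>word_cong X R `` {w}. word_cong X R `` {a @ b})
      = word_cong X R `` {v @ w}"
    using eq by blast
  then show ?thesis by (simp add: presented_group_def)
qed

lemma word_cong_inverse:
  "w \<in> words X \<Longrightarrow> (rev (map (\<lambda>(x, b). (x, \<not> b)) w) @ w, []) \<in> word_cong X R"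
proof (induction w)
  case Nil
  show ?case by (simp add: word_cong.refl)
next
  case (Cons p w)
  obtain x b where p: "p = (x, b)" by force
  let ?w' = "rev (map (\<lambda>(x, b). (x, \<not> b)) w)"
  have "(?w' @ w, []) \<in> word_cong X R"
    using Cons by simp
  moreover from this have "?w' \<in> words X"
    using word_cong_words by fastforce
  ultimately show ?case
    using word_cong.cancel[of ?w' X w x "\<not> b" R] Cons.prems p word_cong.trans by fastforce
qed

lemma group_presented_group: "group (presented_group X R)"
proof (rule groupI)
  fix A B C
  assume "A \<in> carrier (presented_group X R)" "B \<in> carrier (presented_group X R)"
  then show "A \<otimes>\<^bsub>presented_group X R\<^esub> B \<in> carrier (presented_group X R)"
    by (elim presented_group_carrierE) (simp add: mult_presented_group word_class_in_carrier)
  assume "C \<in> carrier (presented_group X R)"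
  with \<open>A \<in> _\<close> \<open>B \<in> _\<close> show "A \<otimes>\<^bsub>presented_group X R\<^esub> B \<otimes>\<^bsub>presented_group X R\<^esub> C
      = A \<otimes>\<^bsub>presented_group X R\<^esub> (B \<otimes>\<^bsub>presented_group X R\<^esub> C)"
    by (elim presented_group_carrierE) (simp add: mult_presented_group)
next
  show "\<one>\<^bsub>presented_group X R\<^esub> \<in> carrier (presented_group X R)"
    by (simp add: one_presented_group word_class_in_carrier)
next
  fix A
  assume "A \<in> carrier (presented_group X R)"
  then obtain w where w: "w \<in> words X" "A = word_cong X R `` {w}"
    by (rule presented_group_carrierE)
  then show "\<one>\<^bsub>presented_group X R\<^esub> \<otimes>\<^bsub>presented_group X R\<^esub> A = A"
    by (simp add: one_presented_group mult_presented_group)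
  let ?w' = "rev (map (\<lambda>(x, b). (x, \<not> b)) w)"
  have *: "(?w' @ w, []) \<in> word_cong X R"
    using w(1) by (rule word_cong_inverse)
  then have "?w' \<in> words X"
    using word_cong_words by fastforce
  with w * show "\<exists>B\<in>carrier (presented_group X R).
      B \<otimes>\<^bsub>presented_group X R\<^esub> A = \<one>\<^bsub>presented_group X R\<^esub>"
    by (intro bexI[of _ "word_cong X R `` {?w'}"])
      (simp_all add: one_presented_group mult_presented_group word_class_in_carrier word_class_eqI)
qed

lemma generator_in_carrier:
  "x \<in> X \<Longrightarrow> generator X R x \<in> carrier (presented_group X R)"
  by (simp add: generator_def word_class_in_carrier)

context group
begin

lemma eval_word_closed:
  "f \<in> X \<rightarrow> carrier G \<Longrightarrow> w \<in> words X \<Longrightarrow> eval_word G f w \<in> carrier G"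
  by (induction w) (auto simp: Pi_iff)

lemma eval_word_append:
  assumes "f \<in> X \<rightarrow> carrier G" "v \<in> words X" "w \<in> words X"
  shows "eval_word G f (v @ w) = eval_word G f v \<otimes> eval_word G f w"
  using assms(2)
proof (induction v)
  case Nil
  show ?case using assms by (simp add: eval_word_closed)
next
  case (Cons p v)
  then show ?case
    using assms(1,3)
    by (cases p) (simp add: m_assoc eval_word_closed[OF assms(1)] funcset_mem[OF assms(1)])
qed

lemma eval_word_cong:
  assumes f: "f \<in> X \<rightarrow> carrier G"
    and R: "\<And>l r. (l, r) \<in> R \<Longrightarrow> eval_word G f l = eval_word G f r"
    and vw: "(v, w) \<in> word_cong X R"
  shows "eval_word G f v = eval_word G f w"
  using vw
proof (induction rule: word_cong.induct)
  case (cancel u v x b)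
  then have "f x \<in> carrier G" using f by auto
  moreover have "eval_word G f v \<in> carrier G"
    using cancel f by (auto intro: eval_word_closed)
  ultimately have "eval_word G f ([(x, b), (x, \<not> b)] @ v) = eval_word G f v"
    by (cases b) (simp_all flip: m_assoc)
  then show ?case
    using cancel f by (simp add: eval_word_append del: append.simps eval_word.simps)
next
  case (rel l r u v)
  then show ?case using f R[OF rel(1)] by (simp add: eval_word_append)
qed auto

lemma presented_lift_class:
  assumes f: "f \<in> X \<rightarrow> carrier G"
    and R: "\<And>l r. (l, r) \<in> R \<Longrightarrow> eval_word G f l = eval_word G f r"
    and w: "w \<in> words X"
  shows "presented_lift G f (word_cong X R `` {w}) = eval_word G f w"
proof -
  have "eval_word G f ` (word_cong X R `` {w}) = {eval_word G f w}"
    using eval_word_cong[OF f R] word_cong.refl[OF w] by force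
  then show ?thesis by (simp add: presented_lift_def)
qed

lemma presented_lift_hom:
  assumes f: "f \<in> X \<rightarrow> carrier G"
    and R: "\<And>l r. (l, r) \<in> R \<Longrightarrow> eval_word G f l = eval_word G f r"
  shows "presented_lift G f \<in> hom (presented_group X R) G"
proof (rule homI)
  fix A B
  assume "A \<in> carrier (presented_group X R)"
  then show "presented_lift G f A \<in> carrier G"
    by (elim presented_group_carrierE) (simp add: presented_lift_class[OF f R] eval_word_closed[OF f])
  assume "B \<in> carrier (presented_group X R)"
  with \<open>A \<in> _\<close> show "presented_lift G f (A \<otimes>\<^bsub>presented_group X R\<^esub> B)
      = presented_lift G f A \<otimes> presented_lift G f B"
    by (elim presented_group_carrierE)
      (simp add: mult_presented_group presented_lift_class[OF f R] eval_word_append[OF f])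
qed

lemma presented_lift_generator:
  assumes f: "f \<in> X \<rightarrow> carrier G"
    and R: "\<And>l r. (l, r) \<in> R \<Longrightarrow> eval_word G f l = eval_word G f r"
    and x: "x \<in> X"
  shows "presented_lift G f (generator X R x) = f x"
proof -
  have "f x \<in> carrier G" using f x by auto
  then show ?thesis
    using x by (simp add: generator_def presented_lift_class[OF f R])
qed

end


section \<open>Twin groups\<close>

definition twin_relations :: "nat \<Rightarrow> (nat word \<times> nat word) set" where
  "twin_relations n =
    {([(i, True), (i, True)], []) | i. i \<in> {1..<n}} \<union>
    {([(i, True), (j, True)], [(j, True), (i, True)]) | i j.
      i \<in> {1..<n} \<and> j \<in> {1..<n} \<and> \<bar>int i - int j\<bar> \<ge> 2}"

definition twin_group :: "nat \<Rightarrow> nat word set monoid" where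
  "twin_group n = presented_group {1..<n} (twin_relations n)"

definition twin_generator :: "nat \<Rightarrow> nat \<Rightarrow> nat word set" where
  "twin_generator n i = generator {1..<n} (twin_relations n) i"

definition twin_perm :: "nat \<Rightarrow> nat word set \<Rightarrow> nat \<Rightarrow> nat" where
  "twin_perm n = presented_lift (sym_group n) (\<lambda>i. transpose i (i + 1))"

definition pure_twin_group :: "nat \<Rightarrow> nat word set set" where
  "pure_twin_group n = kernel (twin_group n) (sym_group n) (twin_perm n)"

text \<open>
  \<open>auto G\<close> is the set of automorphisms of \<open>G\<close>, represented by functions that are
  \<open>undefined\<close> outside the carrier, so that each automorphism occurs exactly once.
\<close>

definition characteristic :: "'a set \<Rightarrow> ('a, 'b) monoid_scheme \<Rightarrow> bool" where
  "characteristic H G \<longleftrightarrow> subgroup H G \<and> (\<forall>\<phi>\<in>auto G. \<phi> ` H = H)"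

lemma group_twin_group: "group (twin_group n)"
  by (simp add: twin_group_def group_presented_group)

lemma transpose_in_sym_group:
  "(\<lambda>i. transpose i (i + 1)) \<in> {1..<n} \<rightarrow> carrier (sym_group n)"
  by (auto simp: sym_group_carrier intro!: permutes_swap_id)

lemma transpose_twin_relations:
  assumes "(l, r) \<in> twin_relations n"
  shows "eval_word (sym_group n) (\<lambda>i. transpose i (i + 1)) l
    = eval_word (sym_group n) (\<lambda>i. transpose i (i + 1)) r"
  using assms
  unfolding twin_relations_def
proof (elim UnE CollectE exE conjE)
  fix i assume "(l, r) = ([(i, True), (i, True)], [])"
  then show ?thesis by (simp add: sym_group_mult sym_group_one)
next
  fix i j :: nat
  assume lr: "(l, r) = ([(i, True), (j, True)], [(j, True), (i, True)])"
    and ij: "\<bar>int i - int j\<bar> \<ge> 2"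
  have "transpose i (i + 1) (transpose j (j + 1) x) = transpose j (j + 1) (transpose i (i + 1) x)"
    for x
    using ij unfolding transpose_def by (smt (verit) of_nat_add of_nat_1)
  then have "transpose i (i + 1) \<circ> transpose j (j + 1)
      = transpose j (j + 1) \<circ> transpose i (i + 1)"
    by (simp add: fun_eq_iff)
  with lr show ?thesis by (simp add: sym_group_mult sym_group_one)
qed

lemma twin_perm_hom: "twin_perm n \<in> hom (twin_group n) (sym_group n)"
  unfolding twin_perm_def twin_group_def
  using sym_group_is_group transpose_in_sym_group transpose_twin_relations
  by (rule group.presented_lift_hom)

lemma twin_perm_generator:
  "i \<in> {1..<n} \<Longrightarrow> twin_perm n (twin_generator n i) = transpose i (i + 1)"
  unfolding twin_perm_def twin_generator_def
  using group.presented_lift_generator[OF sym_group_is_group transpose_in_sym_group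
      transpose_twin_relations] by blast

lemma subgroup_pure_twin_group: "subgroup (pure_twin_group n) (twin_group n)"
  unfolding pure_twin_group_def
  by (intro group_hom.subgroup_kernel group_hom.intro group_hom_axioms.intro
      group_twin_group sym_group_is_group twin_perm_hom)

end

theory Submission
  imports Defs
begin

text \<open>
  For \<open>n \<ge> 4\<close> every generator that commutes with \<open>s\<^sub>3\<close> also commutes with \<open>s\<^sub>1\<close>, so the transvection
  \<open>s\<^sub>3 \<mapsto> s\<^sub>1 s\<^sub>3\<close> that fixes all other generators is an involutive automorphism. It sends the pure
  element \<open>(s\<^sub>2 s\<^sub>3)\<^sup>3\<close> to \<open>(s\<^sub>2 s\<^sub>1 s\<^sub>3)\<^sup>3\<close>, whose permutation is the cube of a 4-cycle.
  For \<open>n = 3\<close> the group is infinite dihedral and the pure subgroup consists of the cubes of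
  rotations. An automorphism maps \<open>s\<^sub>1 s\<^sub>2\<close> to a rotation: this is clear unless exactly one of the
  images of \<open>s\<^sub>1\<close> and \<open>s\<^sub>2\<close> is a rotation, but then that rotation is its own inverse and commutes
  with the other image, whereas \<open>s\<^sub>1\<close> and \<open>s\<^sub>2\<close> do not commute.
\<close>

section \<open>Characteristic subgroups, and twin groups generated by involutions\<close>

text \<open>The inverse of an automorphism is again an automorphism, so applying the inclusion to it
  yields the reverse inclusion for the original one.\<close>

lemma (in group) characteristicI:
  assumes "subgroup H G" and "\<And>\<phi>. \<phi> \<in> auto G \<Longrightarrow> \<phi> ` H \<subseteq> H"
  shows "characteristic H G"
  unfolding characteristic_def
proof (intro conjI ballI equalityI)
  fix \<phi> assume \<phi>: "\<phi> \<in> auto G"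
  then have bij: "\<phi> \<in> Bij (carrier G)" and hom: "\<phi> \<in> hom G G"
    by (auto simp: auto_def)
  \<comment> \<open>The inverse is restricted because members of \<open>auto G\<close> are
    \<open>undefined\<close> outside the carrier.\<close>
  let ?\<psi> = "restrict (inv_into (carrier G) \<phi>) (carrier G)"
  have surj: "\<phi> ` carrier G = carrier G"
    using bij by (simp add: Bij_def bij_betw_def)
  have "?\<psi> \<in> auto G"
    using hom bij by (simp add: auto_def restrict_inv_into_Bij restrict_inv_into_hom del: restrict_apply)
  then have \<psi>: "?\<psi> ` H \<subseteq> H" by (rule assms(2))
  show "H \<subseteq> \<phi> ` H"
  proof
    fix x assume "x \<in> H"
    moreover from this have "x \<in> carrier G" using assms(1) subgroup.subset by blast
    ultimately show "x \<in> \<phi> ` H"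
      using \<psi> surj by (intro image_eqI[of _ _ "?\<psi> x"]) (auto simp: f_inv_into_f)
  qed
qed (use assms in auto)

lemma twin_generator_closed:
  "i \<in> {1..<n} \<Longrightarrow> twin_generator n i \<in> carrier (twin_group n)"
  by (simp add: twin_generator_def twin_group_def generator_in_carrier)

lemma twin_generator_square:
  assumes "i \<in> {1..<n}"
  shows "twin_generator n i \<otimes>\<^bsub>twin_group n\<^esub> twin_generator n i = \<one>\<^bsub>twin_group n\<^esub>"
proof -
  have "([(i, True), (i, True)], []) \<in> twin_relations n"
    using assms by (auto simp: twin_relations_def)
  from word_cong.rel[OF this, of "{1..<n}" "[]" "[]"] show ?thesis
    using assms unfolding twin_generator_def generator_def twin_group_def
    by (simp add: mult_presented_group one_presented_group word_class_eqI)
qed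

lemma twin_generator_commute:
  assumes "i \<in> {1..<n}" "j \<in> {1..<n}" "\<bar>int i - int j\<bar> \<ge> 2"
  shows "twin_generator n i \<otimes>\<^bsub>twin_group n\<^esub> twin_generator n j
    = twin_generator n j \<otimes>\<^bsub>twin_group n\<^esub> twin_generator n i"
proof -
  have "([(i, True), (j, True)], [(j, True), (i, True)]) \<in> twin_relations n"
    using assms unfolding twin_relations_def by blast
  from word_cong.rel[OF this, of "{1..<n}" "[]" "[]"] show ?thesis
    using assms unfolding twin_generator_def generator_def twin_group_def
    by (simp add: mult_presented_group word_class_eqI)
qed

text \<open>Each generator is its own inverse, so negative letters of a word can be replaced by
  positive ones. Induction over words then only has to treat left multiplication by a
  generator.\<close>

lemma twin_group_induct [consumes 1, case_names one mult]:
  assumes "A \<in> carrier (twin_group n)"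
    and one: "P \<one>\<^bsub>twin_group n\<^esub>"
    and mult: "\<And>i A. i \<in> {1..<n} \<Longrightarrow> A \<in> carrier (twin_group n) \<Longrightarrow> P A \<Longrightarrow>
      P (twin_generator n i \<otimes>\<^bsub>twin_group n\<^esub> A)"
  shows "P A"
proof -
  let ?X = "{1..<n}" and ?R = "twin_relations n"
  have "P (word_cong ?X ?R `` {w})" if "w \<in> words ?X" for w
    using that
  proof (induction w)
    case Nil
    then show ?case using one by (simp add: twin_group_def one_presented_group)
  next
    case (Cons p w)
    obtain i b where p: "p = (i, b)" by force
    have i: "i \<in> ?X" and w: "w \<in> words ?X" using Cons.prems p by auto
    have rel: "([(i, True), (i, True)], []) \<in> ?R"
      using i by (auto simp: twin_relations_def)
    have "([(i, b)], [(i, True)]) \<in> word_cong ?X ?R"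
    proof (cases b)
      case True
      then show ?thesis using i by (simp add: word_cong.refl)
    next
      case False
      \<comment> \<open>The word \<open>i^-1 i i\<close> links the two letters: the relation deletes
        \<open>i i\<close> and leaves \<open>i^-1\<close>, while free cancellation deletes
        \<open>i^-1 i\<close> and leaves \<open>i\<close>.\<close>
      have "([(i, False), (i, True), (i, True)], [(i, False)]) \<in> word_cong ?X ?R"
        using word_cong.rel[OF rel, of ?X "[(i, False)]" "[]"] i by simp
      moreover have "([(i, False), (i, True), (i, True)], [(i, True)]) \<in> word_cong ?X ?R"
        using word_cong.cancel[of "[]" ?X "[(i, True)]" i False ?R] i by simp
      ultimately show ?thesis using word_cong.trans[OF word_cong.sym] False by simp
    qed
    from word_cong_append[OF this word_cong.refl[OF w]]
    have "word_cong ?X ?R `` {p # w} = word_cong ?X ?R `` {[(i, True)] @ w}"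
      by (simp add: p word_class_eqI)
    also have "\<dots> = twin_generator n i \<otimes>\<^bsub>twin_group n\<^esub> (word_cong ?X ?R `` {w})"
      using i w by (simp add: twin_generator_def generator_def twin_group_def mult_presented_group)
    finally show ?case
      using mult[OF i _ Cons.IH[OF w]] w by (simp add: twin_group_def word_class_in_carrier)
  qed
  with assms(1) show ?thesis
    unfolding twin_group_def by (blast elim: presented_group_carrierE)
qed

section \<open>The transvection automorphism and the failure for \<open>n \<ge> 4\<close>\<close>

definition twin_transvection :: "nat \<Rightarrow> nat \<Rightarrow> nat word set" where
  "twin_transvection n i = (if i = 3 then twin_generator n 1 \<otimes>\<^bsub>twin_group n\<^esub> twin_generator n 3
     else twin_generator n i)"

lemma twin_transvection_closed:
  assumes "n \<ge> 4"
  shows "twin_transvection n \<in> {1..<n} \<rightarrow> carrier (twin_group n)"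
proof -
  interpret group "twin_group n" by (rule group_twin_group)
  show ?thesis using assms
    by (auto simp: twin_transvection_def intro!: m_closed twin_generator_closed)
qed

lemma (in group) mult_commute_mult:
  assumes "a \<in> carrier G" "b \<in> carrier G" "c \<in> carrier G"
    and "a \<otimes> c = c \<otimes> a" "b \<otimes> c = c \<otimes> b"
  shows "(a \<otimes> b) \<otimes> c = c \<otimes> (a \<otimes> b)"
  using assms by (metis m_assoc)

text \<open>Only relations that involve index 3 change. The new square is trivial because
  \<open>s_1\<close> and \<open>s_3\<close> are commuting involutions, and the new commutations
  follow because whatever commutes with both factors commutes with their product.\<close>

lemma twin_transvection_relations:
  assumes n: "n \<ge> 4" and lr: "(l, r) \<in> twin_relations n"
  shows "eval_word (twin_group n) (twin_transvection n) l
    = eval_word (twin_group n) (twin_transvection n) r"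
proof -
  interpret group "twin_group n" by (rule group_twin_group)
  let ?s = "twin_generator n" and ?t = "twin_transvection n"
  have closed: "?t i \<in> carrier (twin_group n)" if "i \<in> {1..<n}" for i
    using twin_transvection_closed[OF n] that by auto
  have sc: "?s i \<in> carrier (twin_group n)" if "i \<in> {1..<n}" for i
    using that by (rule twin_generator_closed)
  have s13: "?s 1 \<otimes>\<^bsub>twin_group n\<^esub> ?s 3 = ?s 3 \<otimes>\<^bsub>twin_group n\<^esub> ?s 1"
    using n by (intro twin_generator_commute) auto
  have sq: "?t i \<otimes>\<^bsub>twin_group n\<^esub> ?t i = \<one>\<^bsub>twin_group n\<^esub>" if i: "i \<in> {1..<n}" for i
  proof (cases "i = 3")
    case True
    have 1: "?s 1 \<in> carrier (twin_group n)" "?s 3 \<in> carrier (twin_group n)"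
      using n by (auto intro!: sc)
    have 2: "?s 1 \<otimes>\<^bsub>twin_group n\<^esub> ?s 1 = \<one>\<^bsub>twin_group n\<^esub>"
      "?s 3 \<otimes>\<^bsub>twin_group n\<^esub> ?s 3 = \<one>\<^bsub>twin_group n\<^esub>"
      using n by (auto intro!: twin_generator_square)
    have "(?s 1 \<otimes>\<^bsub>twin_group n\<^esub> ?s 3) \<otimes>\<^bsub>twin_group n\<^esub> (?s 1 \<otimes>\<^bsub>twin_group n\<^esub> ?s 3)
        = (?s 1 \<otimes>\<^bsub>twin_group n\<^esub> ?s 3) \<otimes>\<^bsub>twin_group n\<^esub> (?s 3 \<otimes>\<^bsub>twin_group n\<^esub> ?s 1)"
      by (simp only: s13)
    also have "\<dots> = ?s 1 \<otimes>\<^bsub>twin_group n\<^esub> (?s 3 \<otimes>\<^bsub>twin_group n\<^esub> ?s 3) \<otimes>\<^bsub>twin_group n\<^esub> ?s 1"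
      using 1 by (simp add: m_assoc)
    also have "\<dots> = \<one>\<^bsub>twin_group n\<^esub>"
      using 1 by (simp add: 2 del: One_nat_def)
    finally show ?thesis using True by (simp add: twin_transvection_def)
  next
    case False
    then show ?thesis using i by (simp add: twin_transvection_def twin_generator_square)
  qed
  have comm3: "?t 3 \<otimes>\<^bsub>twin_group n\<^esub> ?t j = ?t j \<otimes>\<^bsub>twin_group n\<^esub> ?t 3"
    if j: "j \<in> {1..<n}" and d: "\<bar>3 - int j\<bar> \<ge> 2" for j
  proof -
    have "?s 1 \<otimes>\<^bsub>twin_group n\<^esub> ?s j = ?s j \<otimes>\<^bsub>twin_group n\<^esub> ?s 1"
    \<comment> \<open>An index at distance at least 2 from 3 is either 1, where the claim is
      trivial, or at least 5 and hence far from 1.\<close>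
    proof (cases "j = 1")
      case False
      then show ?thesis using n j d by (intro twin_generator_commute) auto
    qed simp
    moreover have "?s 3 \<otimes>\<^bsub>twin_group n\<^esub> ?s j = ?s j \<otimes>\<^bsub>twin_group n\<^esub> ?s 3"
      using n j d by (intro twin_generator_commute) auto
    ultimately have "(?s 1 \<otimes>\<^bsub>twin_group n\<^esub> ?s 3) \<otimes>\<^bsub>twin_group n\<^esub> ?s j
        = ?s j \<otimes>\<^bsub>twin_group n\<^esub> (?s 1 \<otimes>\<^bsub>twin_group n\<^esub> ?s 3)"
      using n j by (intro mult_commute_mult) (auto intro!: sc)
    then show ?thesis using d by (auto simp: twin_transvection_def)
  qed
  have comm: "?t i \<otimes>\<^bsub>twin_group n\<^esub> ?t j = ?t j \<otimes>\<^bsub>twin_group n\<^esub> ?t i"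
    if "i \<in> {1..<n}" "j \<in> {1..<n}" "\<bar>int i - int j\<bar> \<ge> 2" for i j
  proof -
    consider "i = 3" | "j = 3" | "i \<noteq> 3" "j \<noteq> 3" by blast
    then show ?thesis
    proof cases
      case 1
      then show ?thesis using comm3[of j] that by simp
    next
      case 2
      then show ?thesis using comm3[of i] that by simp
    next
      case 3
      then show ?thesis using that by (simp add: twin_transvection_def twin_generator_commute)
    qed
  qed
  from lr show ?thesis unfolding twin_relations_def
    by (elim UnE CollectE exE conjE) (simp_all add: closed sq comm)
qed

lemma pure_twin_group_not_characteristic:
  assumes n: "n \<ge> 4"
  shows "\<not> characteristic (pure_twin_group n) (twin_group n)"
proof
  assume char: "characteristic (pure_twin_group n) (twin_group n)"
  interpret group "twin_group n" by (rule group_twin_group)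
  let ?G = "twin_group n" and ?s = "twin_generator n"
  define \<theta> where "\<theta> = presented_lift ?G (twin_transvection n)"
  have hom: "\<theta> \<in> hom ?G ?G"
    using presented_lift_hom[OF twin_transvection_closed[OF n] twin_transvection_relations[OF n],
        of "twin_relations n"]
    unfolding \<theta>_def twin_group_def[of n, symmetric] by blast
  then interpret \<theta>: group_hom ?G ?G \<theta>
    by (simp add: group_hom_def group_hom_axioms_def is_group)
  have gen: "\<theta> (?s i) = twin_transvection n i" if "i \<in> {1..<n}" for i
    using presented_lift_generator[OF twin_transvection_closed[OF n]
        twin_transvection_relations[OF n] that]
    by (simp add: \<theta>_def twin_generator_def)
  have sc: "?s i \<in> carrier ?G" if "i \<in> {1..<n}" for i
    using that by (rule twin_generator_closed)
  have s: "?s 1 \<in> carrier ?G" "?s 2 \<in> carrier ?G" "?s 3 \<in> carrier ?G"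
    using n by (auto intro!: sc)
  \<comment> \<open>Being its own inverse makes \<open>\<theta>\<close> bijective. On generators
    this rests on \<open>s_1 s_1 s_3 = s_3\<close>, and the induction extends it to all
    elements.\<close>
  have invol: "\<theta> (\<theta> A) = A" if "A \<in> carrier ?G" for A
    using that
  proof (induction rule: twin_group_induct)
    case (mult i A)
    have "\<theta> (\<theta> (?s i)) = ?s i"
    proof (cases "i = 3")
      case True
      have "\<theta> (\<theta> (?s 3)) = ?s 1 \<otimes>\<^bsub>?G\<^esub> (?s 1 \<otimes>\<^bsub>?G\<^esub> ?s 3)"
        using n s by (simp add: gen twin_transvection_def)
      also have "\<dots> = ?s 3"
        using n s twin_generator_square[of 1 n] by (simp flip: m_assoc)
      finally show ?thesis using True by simp
    qed (use mult in \<open>simp add: gen twin_transvection_def\<close>)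
    then show ?case using mult sc by simp
  qed simp
  have "bij_betw \<theta> (carrier ?G) (carrier ?G)"
    by (rule bij_betwI[where g = \<theta>]) (auto simp: invol)
  then have auto: "restrict \<theta> (carrier ?G) \<in> auto ?G"
    using hom by (auto simp: auto_def Bij_def hom_def bij_betw_restrict_eq)
  interpret \<pi>: group_hom ?G "sym_group n" "twin_perm n"
    by (simp add: group_hom_def group_hom_axioms_def is_group sym_group_is_group twin_perm_hom)
  let ?b = "?s 2 \<otimes>\<^bsub>?G\<^esub> ?s 3"
  let ?a = "?b \<otimes>\<^bsub>?G\<^esub> ?b \<otimes>\<^bsub>?G\<^esub> ?b"
  have \<pi>: "twin_perm n (?s 1) = transpose 1 2" "twin_perm n (?s 2) = transpose 2 3"
    "twin_perm n (?s 3) = transpose 3 4"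
    using n twin_perm_generator[of 1 n] twin_perm_generator[of 2 n] twin_perm_generator[of 3 n]
    by (simp_all del: One_nat_def)
  have "twin_perm n ?a = id"
    using s by (simp add: \<pi> sym_group_mult) (auto simp: fun_eq_iff transpose_def)
  then have a: "?a \<in> pure_twin_group n"
    using s by (simp add: pure_twin_group_def kernel_def sym_group_one)
  have "\<theta> ?a \<in> pure_twin_group n"
  proof -
    have "restrict \<theta> (carrier ?G) ` pure_twin_group n = pure_twin_group n"
      using char auto unfolding characteristic_def by blast
    moreover have "restrict \<theta> (carrier ?G) ?a = \<theta> ?a" using s by simp
    ultimately show ?thesis using a by (metis image_eqI)
  qed
  \<comment> \<open>The contradiction is read off at the point 1: the permutation of
    \<open>s_2 s_1 s_3\<close> runs through 1, 3, 4, 2 cyclically, so its cube sends 1 to 2.\<close>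
  then have "twin_perm n (\<theta> ?a) 1 = 1"
    by (simp add: pure_twin_group_def kernel_def sym_group_one)
  moreover have "\<theta> (?s 3) = ?s 1 \<otimes>\<^bsub>?G\<^esub> ?s 3" "\<theta> (?s 2) = ?s 2"
    using n gen[of 3] gen[of 2] by (simp_all add: twin_transvection_def)
  ultimately show False
    using s by (simp add: \<pi> sym_group_mult transpose_def del: One_nat_def)
qed

section \<open>The case of two strands: a group with two elements\<close>

text \<open>The only elements are the identity and \<open>s_1\<close>, and \<open>s_1\<close> acts
  as a nontrivial transposition. The pure subgroup is therefore trivial, and every homomorphism
  preserves it.\<close>

lemma characteristic_pure_twin_group_2: "characteristic (pure_twin_group 2) (twin_group 2)"
proof -
  interpret group "twin_group 2" by (rule group_twin_group)
  interpret \<pi>: group_hom "twin_group 2" "sym_group 2" "twin_perm 2"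
    by (simp add: group_hom_def group_hom_axioms_def is_group sym_group_is_group twin_perm_hom)
  have s: "twin_generator 2 1 \<in> carrier (twin_group 2)"
    by (simp add: twin_generator_closed)
  have *: "A = \<one>\<^bsub>twin_group 2\<^esub> \<or> A = twin_generator 2 1" if "A \<in> carrier (twin_group 2)" for A
    using that
  proof (induction rule: twin_group_induct)
    case (mult i A)
    then have "i = 1" by auto
    then show ?case using mult s twin_generator_square[of 1 2] by auto
  qed simp
  have "twin_perm 2 (twin_generator 2 1) \<noteq> id"
    using twin_perm_generator[of 1 2] by (auto simp: fun_eq_iff transpose_def)
  then have "pure_twin_group 2 = {\<one>\<^bsub>twin_group 2\<^esub>}"
    using * by (force simp: pure_twin_group_def kernel_def sym_group_one)
  then show ?thesis
    by (intro characteristicI subgroup_pure_twin_group)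
      (auto simp: auto_def dest!: hom_one[OF _ is_group is_group])
qed

section \<open>The case of three strands: rotations and reflections of the infinite dihedral
  group\<close>

lemma characteristic_pure_twin_group_3: "characteristic (pure_twin_group 3) (twin_group 3)"
proof -
  let ?G = "twin_group 3"
  interpret group ?G by (rule group_twin_group)
  interpret S: group "sym_group 3" by (rule sym_group_is_group)
  interpret \<pi>: group_hom ?G "sym_group 3" "twin_perm 3"
    by (simp add: group_hom_def group_hom_axioms_def is_group sym_group_is_group twin_perm_hom)
  define a b where "a = twin_generator 3 1" and "b = twin_generator 3 2"
  define r where "r = a \<otimes>\<^bsub>?G\<^esub> b"
  have ab [simp]: "a \<in> carrier ?G" "b \<in> carrier ?G"
    by (simp_all add: a_def b_def twin_generator_closed)
  then have r [simp]: "r \<in> carrier ?G" by (simp add: r_def)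
  have a2: "a \<otimes>\<^bsub>?G\<^esub> a = \<one>\<^bsub>?G\<^esub>" and b2: "b \<otimes>\<^bsub>?G\<^esub> b = \<one>\<^bsub>?G\<^esub>"
    by (simp_all add: a_def b_def twin_generator_square)
  have aa: "a \<otimes>\<^bsub>?G\<^esub> (a \<otimes>\<^bsub>?G\<^esub> x) = x" if "x \<in> carrier ?G" for x
    using that a2 by (simp flip: m_assoc)
  have inv_r: "inv\<^bsub>?G\<^esub> r = b \<otimes>\<^bsub>?G\<^esub> a"
    by (rule inv_equality) (simp_all add: r_def m_assoc aa b2)
  have add: "r [^]\<^bsub>?G\<^esub> k \<otimes>\<^bsub>?G\<^esub> r [^]\<^bsub>?G\<^esub> m = r [^]\<^bsub>?G\<^esub> (k + m)" for k m :: int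
    by (simp add: int_pow_mult)
  have conj: "a \<otimes>\<^bsub>?G\<^esub> r [^]\<^bsub>?G\<^esub> k \<otimes>\<^bsub>?G\<^esub> a = r [^]\<^bsub>?G\<^esub> (- k)" for k :: int
  proof -
    \<comment> \<open>Conjugation by the involution \<open>a\<close> is an endomorphism, so
      inverting \<open>r\<close> already implies inverting all its powers.\<close>
    have inner: "(\<lambda>x. a \<otimes>\<^bsub>?G\<^esub> x \<otimes>\<^bsub>?G\<^esub> a) \<in> hom ?G ?G"
      by (rule homI) (simp_all add: m_assoc aa)
    have "a \<otimes>\<^bsub>?G\<^esub> r [^]\<^bsub>?G\<^esub> k \<otimes>\<^bsub>?G\<^esub> a = (a \<otimes>\<^bsub>?G\<^esub> r \<otimes>\<^bsub>?G\<^esub> a) [^]\<^bsub>?G\<^esub> k"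
      using hom_int_pow[OF inner, of r k] is_group by simp
    also have "a \<otimes>\<^bsub>?G\<^esub> r \<otimes>\<^bsub>?G\<^esub> a = inv\<^bsub>?G\<^esub> r"
      by (simp add: inv_r) (simp add: r_def m_assoc aa)
    finally show ?thesis by (simp add: int_pow_inv int_pow_neg)
  qed
  have swap: "r [^]\<^bsub>?G\<^esub> k \<otimes>\<^bsub>?G\<^esub> a = a \<otimes>\<^bsub>?G\<^esub> r [^]\<^bsub>?G\<^esub> (- k)" for k :: int
    using conj[of k] aa[of "r [^]\<^bsub>?G\<^esub> k \<otimes>\<^bsub>?G\<^esub> a"] by (simp add: m_assoc)
  \<comment> \<open>Dihedral normal form: every element is a rotation \<open>r^k\<close> or a
    reflection \<open>a r^k\<close>. Multiplying by \<open>a\<close> or \<open>b\<close> on the left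
    exchanges the two types.\<close>
  have form: "(\<exists>k::int. A = r [^]\<^bsub>?G\<^esub> k) \<or> (\<exists>k::int. A = a \<otimes>\<^bsub>?G\<^esub> r [^]\<^bsub>?G\<^esub> k)"
    if "A \<in> carrier ?G" for A
    using that
  proof (induction rule: twin_group_induct)
    case one
    have "\<one>\<^bsub>?G\<^esub> = r [^]\<^bsub>?G\<^esub> (0::int)" by simp
    then show ?case by blast
  next
    case (mult i A)
    then have "i = 1 \<or> i = 2" by auto
    then show ?case
    proof
      assume "i = 1"
      then show ?thesis using mult.IH aa by (auto simp: a_def[symmetric] simp del: One_nat_def)
    next
      assume i: "i = 2"
      have b: "b = a \<otimes>\<^bsub>?G\<^esub> r" by (simp add: r_def aa)
      have 1: "b \<otimes>\<^bsub>?G\<^esub> r [^]\<^bsub>?G\<^esub> k = a \<otimes>\<^bsub>?G\<^esub> r [^]\<^bsub>?G\<^esub> (1 + k)" for k :: int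
        using add[of 1 k] by (simp add: b m_assoc)
      have 2: "b \<otimes>\<^bsub>?G\<^esub> (a \<otimes>\<^bsub>?G\<^esub> r [^]\<^bsub>?G\<^esub> k) = r [^]\<^bsub>?G\<^esub> (- 1 + k)" for k :: int
        using add[of "- 1" k] inv_r by (simp add: int_pow_neg flip: m_assoc)
      show ?thesis using mult.IH 1 2 i by (auto simp: b_def[symmetric])
    qed
  qed
  let ?S = "sym_group 3"
  define c where "c = twin_perm 3 r"
  have \<pi>: "twin_perm 3 a = transpose 1 2" "twin_perm 3 b = transpose 2 3"
    using twin_perm_generator[of 1 3] twin_perm_generator[of 2 3] by (simp_all add: a_def b_def del: One_nat_def)
  have c_cycle: "c x = (if x = 1 then 2 else if x = 2 then 3 else if x = 3 then 1 else x)" for x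
    by (simp add: c_def r_def \<pi> sym_group_mult transpose_def)
  have [simp]: "c \<in> carrier ?S" by (simp add: c_def)
  \<comment> \<open>Since \<open>c\<close> is a 3-cycle, these are all the permutations
    \<open>c^k\<close> and \<open>transpose 1 2 \<circ> c^k\<close> apart from the identity
    itself.\<close>
  have ne: "c \<noteq> id" "c \<circ> c \<noteq> id" "transpose 1 2 \<circ> c \<noteq> id" "transpose 1 2 \<circ> (c \<circ> c) \<noteq> id"
    "transpose 1 (2::nat) \<noteq> id"
    using c_cycle by (auto simp: fun_eq_iff transpose_def intro: exI[of _ 1])
  have c2: "c [^]\<^bsub>?S\<^esub> (2::int) = c \<circ> c"
    using S.int_pow_mult[of c 1 1] by (simp add: sym_group_mult)
  have "c [^]\<^bsub>?S\<^esub> (3::int) = c \<circ> (c \<circ> c)"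
    using S.int_pow_mult[of c 1 2] c2 by (simp add: sym_group_mult)
  also have "\<dots> = \<one>\<^bsub>?S\<^esub>"
    by (simp add: c_cycle fun_eq_iff sym_group_one)
  finally have c3: "c [^]\<^bsub>?S\<^esub> (3 * k) = \<one>\<^bsub>?S\<^esub>" for k :: int
    by (simp flip: S.int_pow_pow)
  have \<pi>_pow: "twin_perm 3 (r [^]\<^bsub>?G\<^esub> k) = c [^]\<^bsub>?S\<^esub> k" for k :: int
    by (simp add: c_def \<pi>.hom_int_pow)
  \<comment> \<open>Powers of \<open>c\<close> depend only on the exponent modulo 3. The
    divisibility is recorded so that a pure rotation can be recognised as a power of
    \<open>r^3\<close>.\<close>
  have cases: "3 dvd k \<and> c [^]\<^bsub>?S\<^esub> k = id \<or> c [^]\<^bsub>?S\<^esub> k = c \<or> c [^]\<^bsub>?S\<^esub> k = c \<circ> c" for k :: int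
  proof -
    have "c [^]\<^bsub>?S\<^esub> k = c [^]\<^bsub>?S\<^esub> (3 * (k div 3) + k mod 3)" by simp
    also have "\<dots> = c [^]\<^bsub>?S\<^esub> (k mod 3)"
      by (subst S.int_pow_mult) (simp_all only: \<open>c \<in> carrier ?S\<close> c3 S.l_one S.int_pow_closed)
    finally have "c [^]\<^bsub>?S\<^esub> k = c [^]\<^bsub>?S\<^esub> (k mod 3)" .
    moreover have "k mod 3 = 0 \<or> k mod 3 = 1 \<or> k mod 3 = 2" by presburger
    ultimately show ?thesis using c2 by (auto simp: sym_group_one)
  qed
  have pureE: "\<exists>m::int. A = r [^]\<^bsub>?G\<^esub> (3 * m)" if "A \<in> pure_twin_group 3" for A
  proof -
    have A: "A \<in> carrier ?G" "twin_perm 3 A = id"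
      using that by (auto simp: pure_twin_group_def kernel_def sym_group_one)
    from form[OF A(1)] show ?thesis
    proof (elim disjE exE)
      fix k :: int assume k: "A = r [^]\<^bsub>?G\<^esub> k"
      then have "c [^]\<^bsub>?S\<^esub> k = id" using A(2) \<pi>_pow by simp
      then have "3 dvd k" using cases[of k] ne by auto
      then show ?thesis using k by auto
    next
      fix k :: int assume "A = a \<otimes>\<^bsub>?G\<^esub> r [^]\<^bsub>?G\<^esub> k"
      then have "transpose 1 2 \<circ> c [^]\<^bsub>?S\<^esub> k = id"
        using A(2) by (simp add: \<pi> \<pi>_pow sym_group_mult)
      then show ?thesis using cases[of k] ne by auto
    qed
  qed
  have noncomm: "a \<otimes>\<^bsub>?G\<^esub> b \<noteq> b \<otimes>\<^bsub>?G\<^esub> a"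
  proof
    assume "a \<otimes>\<^bsub>?G\<^esub> b = b \<otimes>\<^bsub>?G\<^esub> a"
    \<comment> \<open>The permutation of \<open>a b\<close> sends 1 to 2, that of \<open>b a\<close>
      sends 1 to 3.\<close>
    then have "twin_perm 3 (a \<otimes>\<^bsub>?G\<^esub> b) 1 = twin_perm 3 (b \<otimes>\<^bsub>?G\<^esub> a) 1" by simp
    then show False by (simp add: \<pi> sym_group_mult transpose_def del: One_nat_def)
  qed
  \<comment> \<open>A rotation of square one satisfies \<open>r^(-k) = r^k\<close>, so the sign
    change caused by moving it past \<open>a\<close> has no effect and it commutes with every
    reflection.\<close>
  have commute: "x \<otimes>\<^bsub>?G\<^esub> y = y \<otimes>\<^bsub>?G\<^esub> x"
    if "x \<otimes>\<^bsub>?G\<^esub> x = \<one>\<^bsub>?G\<^esub>" "x = r [^]\<^bsub>?G\<^esub> k" "y = a \<otimes>\<^bsub>?G\<^esub> r [^]\<^bsub>?G\<^esub> m" for x y and k m :: int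
  proof -
    have "inv\<^bsub>?G\<^esub> x = x" using that by (intro inv_equality) auto
    then have x: "r [^]\<^bsub>?G\<^esub> (- k) = r [^]\<^bsub>?G\<^esub> k" using that by (simp add: int_pow_neg)
    have "x \<otimes>\<^bsub>?G\<^esub> y = (r [^]\<^bsub>?G\<^esub> k \<otimes>\<^bsub>?G\<^esub> a) \<otimes>\<^bsub>?G\<^esub> r [^]\<^bsub>?G\<^esub> m"
      using that by (simp add: m_assoc)
    also have "\<dots> = a \<otimes>\<^bsub>?G\<^esub> r [^]\<^bsub>?G\<^esub> (k + m)"
      by (simp add: swap x m_assoc add)
    also have "\<dots> = y \<otimes>\<^bsub>?G\<^esub> x"
      using that by (simp add: m_assoc add add.commute)
    finally show ?thesis .
  qed
  show ?thesis
  proof (intro characteristicI subgroup_pure_twin_group subsetI)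
    fix \<phi> B assume "\<phi> \<in> auto ?G" and "B \<in> \<phi> ` pure_twin_group 3"
    then have hom: "\<phi> \<in> hom ?G ?G" and inj: "inj_on \<phi> (carrier ?G)"
      by (auto simp: auto_def Bij_def bij_betw_def)
    interpret \<phi>: group_hom ?G ?G \<phi>
      using hom by (simp add: group_hom_def group_hom_axioms_def is_group)
    have \<phi>2: "\<phi> a \<otimes>\<^bsub>?G\<^esub> \<phi> a = \<one>\<^bsub>?G\<^esub>" "\<phi> b \<otimes>\<^bsub>?G\<^esub> \<phi> b = \<one>\<^bsub>?G\<^esub>"
      by (simp_all add: a2 b2 flip: \<phi>.hom_mult)
    have \<phi>_noncomm: "\<phi> a \<otimes>\<^bsub>?G\<^esub> \<phi> b \<noteq> \<phi> b \<otimes>\<^bsub>?G\<^esub> \<phi> a"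
      using noncomm inj_onD[OF inj] by (metis \<phi>.hom_mult ab m_closed)
    \<comment> \<open>The images of \<open>a\<close> and \<open>b\<close> have the same type: in the
      two mixed cases \<open>commute\<close> contradicts \<open>\<phi>_noncomm\<close>. A product of
      two rotations or of two reflections is a rotation.\<close>
    have "\<exists>j::int. \<phi> r = r [^]\<^bsub>?G\<^esub> j"
      using form[OF \<phi>.hom_closed[OF ab(1)]] form[OF \<phi>.hom_closed[OF ab(2)]]
    proof (elim disjE exE)
      fix k m :: int
      assume "\<phi> a = r [^]\<^bsub>?G\<^esub> k" "\<phi> b = r [^]\<^bsub>?G\<^esub> m"
      then have "\<phi> r = r [^]\<^bsub>?G\<^esub> (k + m)" by (simp add: r_def add[unfolded r_def])
      then show ?thesis by blast
    next
      fix k m :: int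
      assume "\<phi> a = r [^]\<^bsub>?G\<^esub> k" "\<phi> b = a \<otimes>\<^bsub>?G\<^esub> r [^]\<^bsub>?G\<^esub> m"
      then show ?thesis using commute \<phi>2 \<phi>_noncomm by blast
    next
      fix k m :: int
      assume "\<phi> a = a \<otimes>\<^bsub>?G\<^esub> r [^]\<^bsub>?G\<^esub> k" "\<phi> b = r [^]\<^bsub>?G\<^esub> m"
      then show ?thesis using commute \<phi>2 \<phi>_noncomm by metis
    next
      fix k m :: int
      assume "\<phi> a = a \<otimes>\<^bsub>?G\<^esub> r [^]\<^bsub>?G\<^esub> k" "\<phi> b = a \<otimes>\<^bsub>?G\<^esub> r [^]\<^bsub>?G\<^esub> m"
      moreover have "\<phi> r = \<phi> a \<otimes>\<^bsub>?G\<^esub> \<phi> b" by (simp add: r_def)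
      ultimately have "\<phi> r = (a \<otimes>\<^bsub>?G\<^esub> r [^]\<^bsub>?G\<^esub> k \<otimes>\<^bsub>?G\<^esub> a) \<otimes>\<^bsub>?G\<^esub> r [^]\<^bsub>?G\<^esub> m"
        by (simp add: m_assoc)
      also have "\<dots> = r [^]\<^bsub>?G\<^esub> (- k + m)" by (simp only: conj add)
      finally show ?thesis by blast
    qed
    then obtain j :: int where j: "\<phi> r = r [^]\<^bsub>?G\<^esub> j" by blast
    obtain A where A: "A \<in> pure_twin_group 3" "B = \<phi> A"
      using \<open>B \<in> _\<close> by blast
    obtain m :: int where "A = r [^]\<^bsub>?G\<^esub> (3 * m)" using pureE[OF A(1)] by blast
    \<comment> \<open>The factor 3 in the exponent survives the substitution of \<open>r^j\<close>
      for \<open>r\<close>, and \<open>c3\<close> turns it back into purity.\<close>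
    then have "B = r [^]\<^bsub>?G\<^esub> (3 * (j * m))"
      using A(2) j by (simp add: \<phi>.hom_int_pow int_pow_pow mult.left_commute)
    then show "B \<in> pure_twin_group 3"
      by (simp add: pure_twin_group_def kernel_def \<pi>_pow c3)
  qed
qed

theorem proposition6p11:
  fixes n :: nat
  assumes "n \<ge> 2"
  shows "characteristic (pure_twin_group n) (twin_group n) \<longleftrightarrow> n = 2 \<or> n = 3"
proof -
  have "n = 2 \<or> n = 3 \<or> n \<ge> 4" using assms by linarith
  then show ?thesis
    using pure_twin_group_not_characteristic characteristic_pure_twin_group_2 characteristic_pure_twin_group_3 by auto
qed

end
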